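(* Let $n\ge1$. The map $u\mapsto(\lambda^u,E^u)$, defined on signed permutations of $[n]$, restricts to a bijection from the set $D_n$ of even-signed permutations of $[n]$ onto the set $TG_n$ of pairs $(w,E)$ such that $([n],E)$ is a threshold graph and $w$ is a degree ordering of $([n],E)$.
   Context: $[n]=\{1,\dots,n\}$. A signed permutation of $[n]$ is a permutation $u$ of $\{-n,\dots,-1,1,\dots,n\}$ with $u_{-i}=-u_i$; it is even signed if the number of negative entries among $u_1,\dots,u_n$ is even. Its full notation is the word $u_{-n}\cdots u_{-1}u_1\cdots u_n$. Path representation: reading the full notation of $u$ from left to right, draw a lattice path $\pi^u$ from $(0,n)$ to $(n,0)$ by making a unit East step for each positive letter and a unit South step for each negative letter. Let $\lambda^u$ be the subword of the full notation of $u$ consisting of the positive letters; it is a permutation $\lambda^u_1\cdots\lambda^u_n$ of $[n]$, viewed as the bijection $x\mapsto \lambda^u_x$. For $x,y\in[n]$, the cell $(x,y)$ (the unit square with upper right corner $(x,y)$) lies below $\pi^u$ iff $y$ is at most the height (ordinate) of the $x$-th East step of $\pi^u$; the set of cells below $\pi^u$ is symmetric under $(x,y)\mapsto(y,x)$. Put $$E^u=\{\{i,j\}: i,j\in[n],\ i\ne j,\ \text{the cell }((\lambda^u)^{-1}(i),(\lambda^u)^{-1}(j))\text{ lies below }\pi^u\}.$$ A simple graph is threshold if it has no induced subgraph isomorphic to $2K_2$ (two disjoint edges), the path with three edges on four vertices, or the 4-cycle $C_4$. A permutation $w=w_1\cdots w_n$ of $[n]$ is a degree ordering of a graph $([n],E)$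 if $\deg_E(w_1)\ge\deg_E(w_2)\ge\dots\ge\deg_E(w_n)$. *)

theory Defs
  imports Complex_Main "HOL-Combinatorics.Permutations" "HOL-Combinatorics.Multiset_Permutations"
begin

section \<open>Signed permutations\<close>

text \<open>Since \<open>permutes\<close> requires \<open>u\<close> to be the identity off the given set, a signed
  permutation is represented by exactly one function.\<close>

definition signed_perms :: "nat \<Rightarrow> (int \<Rightarrow> int) set" where
  "signed_perms n =
     {u. u permutes ({- int n..int n} - {0}) \<and> (\<forall>i \<in> {- int n..int n} - {0}. u (- i) = - u i)}"

definition even_signed_perms :: "nat \<Rightarrow> (int \<Rightarrow> int) set" where
  "even_signed_perms n = {u \<in> signed_perms n. even (card {i \<in> {1..int n}. u i < 0})}"

definition full_notation :: "nat \<Rightarrow> (int \<Rightarrow> int) \<Rightarrow> int list" where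
  "full_notation n u = map u ([- int n..- 1] @ [1..int n])"

section \<open>The path representation\<close>

datatype step = East | South

definition path_of :: "nat \<Rightarrow> (int \<Rightarrow> int) \<Rightarrow> step list" where
  "path_of n u = map (\<lambda>a. if a > 0 then East else South) (full_notation n u)"

text \<open>\<open>east_heights h p\<close> lists the ordinates of the successive East steps of the lattice path
  with step word \<open>p\<close> that starts at height \<open>h\<close>.  The path of a signed permutation of
  \<open>[n]\<close> starts at height \<open>n\<close> and has exactly \<open>n\<close> South steps, so the subtraction
  never truncates there.\<close>

fun east_heights :: "nat \<Rightarrow> step list \<Rightarrow> nat list" where
  "east_heights h [] = []"
| "east_heights h (East # p) = h # east_heights h p"
| "east_heights h (South # p) = east_heights (h - 1) p"

text \<open>Cells are named by their upper right corner, and columns are numbered from 1.\<close>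

definition cell_below :: "nat \<Rightarrow> (int \<Rightarrow> int) \<Rightarrow> nat \<Rightarrow> nat \<Rightarrow> bool" where
  "cell_below n u x y \<longleftrightarrow>
     x \<in> {1..n} \<and> y \<in> {1..n} \<and> y \<le> east_heights n (path_of n u) ! (x - 1)"

definition lam :: "nat \<Rightarrow> (int \<Rightarrow> int) \<Rightarrow> nat list" where
  "lam n u = map nat (filter (\<lambda>a. a > 0) (full_notation n u))"

definition lam_inv :: "nat \<Rightarrow> (int \<Rightarrow> int) \<Rightarrow> nat \<Rightarrow> nat" where
  "lam_inv n u = inv_into {1..n} (\<lambda>x. lam n u ! (x - 1))"

definition edges_of :: "nat \<Rightarrow> (int \<Rightarrow> int) \<Rightarrow> nat set set" where
  "edges_of n u =
     {{i, j} | i j. i \<in> {1..n} \<and> j \<in> {1..n} \<and> i \<noteq> j \<and>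
                    cell_below n u (lam_inv n u i) (lam_inv n u j)}"

section \<open>Threshold graphs and degree orderings\<close>

type_synonym 'a graph = "'a set \<times> 'a set set"

definition simple_graph :: "'a graph \<Rightarrow> bool" where
  "simple_graph G \<longleftrightarrow> (\<forall>e \<in> snd G. e \<subseteq> fst G \<and> card e = 2)"

definition induced_subgraph :: "'a graph \<Rightarrow> 'a set \<Rightarrow> 'a graph" where
  "induced_subgraph G S = (S, {e \<in> snd G. e \<subseteq> S})"

definition graph_iso :: "'a graph \<Rightarrow> 'b graph \<Rightarrow> bool" where
  "graph_iso G H \<longleftrightarrow> (\<exists>f. bij_betw f (fst G) (fst H) \<and> (\<lambda>e. f ` e) ` snd G = snd H)"

definition has_induced :: "'a graph \<Rightarrow> 'b graph \<Rightarrow> bool" where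
  "has_induced G H \<longleftrightarrow> (\<exists>S \<subseteq> fst G. graph_iso (induced_subgraph G S) H)"

definition two_K2 :: "nat graph" where
  "two_K2 = ({1, 2, 3, 4}, {{1, 2}, {3, 4}})"

definition path_P4 :: "nat graph" where
  "path_P4 = ({1, 2, 3, 4}, {{1, 2}, {2, 3}, {3, 4}})"

definition cycle_C4 :: "nat graph" where
  "cycle_C4 = ({1, 2, 3, 4}, {{1, 2}, {2, 3}, {3, 4}, {4, 1}})"

definition threshold_graph :: "'a graph \<Rightarrow> bool" where
  "threshold_graph G \<longleftrightarrow>
     simple_graph G \<and> \<not> has_induced G two_K2 \<and> \<not> has_induced G path_P4 \<and> \<not> has_induced G cycle_C4"

definition degree :: "'a set set \<Rightarrow> 'a \<Rightarrow> nat" where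
  "degree E v = card {e \<in> E. v \<in> e}"

definition degree_ordering :: "nat \<Rightarrow> nat set set \<Rightarrow> nat list \<Rightarrow> bool" where
  "degree_ordering n E w \<longleftrightarrow>
     w \<in> permutations_of_set {1..n} \<and> sorted_wrt (\<ge>) (map (degree E) w)"

definition TG :: "nat \<Rightarrow> (nat list \<times> nat set set) set" where
  "TG n = {(w, E). threshold_graph ({1..n}, E) \<and> degree_ordering n E w}"

end

theory Submission
  imports Defs
begin

text \<open>Give \<open>i\<close> the weight \<open>inv u i\<close>, its position in the full notation. Since the path is symmetric,
  the cell of \<open>i\<close> and \<open>j\<close> lies below it iff the two weights have negative sum, and \<open>lam n u\<close> lists
  \<open>[n]\<close> by increasing weight. So \<open>edges_of n u\<close> is a threshold graph: around a 4-cycle that alternates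
  between edges and non-edges, which is what each of the three forbidden graphs contains, the sum of
  the weights would be both negative and nonnegative. Conversely, in a threshold graph neighbourhoods
  are nested along a degree ordering, so the adjacency relation is a symmetric Young diagram except
  for its diagonal cells. A diagram with prescribed off-diagonal cells determines \<open>u\<close> up to the number
  of diagonal cells, which is the number of negative entries of \<open>u\<close>; there are exactly two
  consecutive choices for it, one of which is even.\<close>

section \<open>Signed permutations as weights\<close>

abbreviation indices :: "nat \<Rightarrow> int list" where
  "indices n \<equiv> [- int n..- 1] @ [1..int n]"

definition weight :: "(int \<Rightarrow> int) \<Rightarrow> nat \<Rightarrow> int" where
  "weight u i = inv u (int i)"

definition east_positions :: "nat \<Rightarrow> (int \<Rightarrow> int) \<Rightarrow> int list" where
  "east_positions n u = filter (\<lambda>k. u k > 0) (indices n)"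

section \<open>Sorted position lists and the heights of East steps\<close>

lemma set_indices: "set (indices n) = {- int n..int n} - {0}"
  by auto

lemma sorted_indices: "sorted_wrt (<) (indices n)"
  by (auto simp: sorted_wrt_append)

text \<open>The path ends at height 0, so the height of an East step is the number of South steps
  still to come. In the induction the head of a sorted list never lies after a later East position,
  so it contributes only to the starting height.\<close>

lemma east_heights_map:
  fixes xs :: "'a::linorder list"
  assumes "sorted_wrt (<) xs"
  shows "east_heights (length (filter (\<lambda>k. \<not> Q k) xs)) (map (\<lambda>k. if Q k then East else South) xs)
       = map (\<lambda>k. length (filter (\<lambda>j. \<not> Q j \<and> k < j) xs)) (filter Q xs)"
  using assms
proof (induction xs)
  case (Cons x xs)
  have "filter (\<lambda>j. \<not> Q j \<and> x < j) xs = filter (\<lambda>j. \<not> Q j) xs"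
    using Cons.prems by (intro filter_cong) auto
  moreover have "\<not> k < x" if "k \<in> set xs" for k
    using Cons.prems that by auto
  ultimately show ?case
    using Cons by (auto cong: map_cong)
qed simp

text \<open>In a strictly sorted list the entries below \<open>c\<close> form an initial segment, so
  its length decides which indices lie in it.\<close>

lemma nth_less_iff_length_filter:
  fixes xs :: "'a::linorder list"
  assumes "sorted_wrt (<) xs" "y < length xs"
  shows "xs ! y < c \<longleftrightarrow> y < length (filter (\<lambda>b. b < c) xs)"
  using assms
proof (induction xs arbitrary: y)
  case (Cons x xs)
  show ?case
  proof (cases "x < c")
    case True
    then show ?thesis using Cons by (cases y) auto
  next
    case False
    have "\<not> z < c" if "z \<in> set (x # xs)" for z
      using False Cons.prems(1) that by auto
    moreover have "(x # xs) ! y \<in> set (x # xs)"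
      using Cons.prems(2) by (rule nth_mem)
    ultimately show ?thesis by (metis filter_False list.size(3) not_less_zero)
  qed
qed simp

section \<open>Weights, heights and edges of a fixed signed permutation\<close>

context
  fixes n :: nat and u :: "int \<Rightarrow> int"
  assumes u: "u \<in> signed_perms n"
begin

lemma signed_permutes: "u permutes ({- int n..int n} - {0})"
  using u by (simp add: signed_perms_def)

lemma signed_uminus: "i \<in> {- int n..int n} - {0} \<Longrightarrow> u (- i) = - u i"
  using u by (auto simp: signed_perms_def)

lemma signed_inv_uminus:
  assumes "i \<in> {- int n..int n} - {0}"
  shows "inv u (- i) = - inv u i"
proof -
  have "inv u i \<in> {- int n..int n} - {0}"
    using permutes_in_image[OF permutes_inv[OF signed_permutes]] assms by blast
  then have "u (- inv u i) = - i"
    using signed_uminus permutes_inverses(1)[OF signed_permutes] by simp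
  then show ?thesis
    using permutes_inverses(2)[OF signed_permutes] by metis
qed

lemma signed_image_weight: "u (weight u i) = int i"
  by (simp add: weight_def permutes_inverses(1)[OF signed_permutes])

lemma weight_in:
  assumes "i \<in> {1..n}"
  shows "weight u i \<in> {- int n..int n} - {0}"
proof -
  have "int i \<in> {- int n..int n} - {0}" using assms by auto
  then show ?thesis
    unfolding weight_def using permutes_in_image[OF permutes_inv[OF signed_permutes]] by blast
qed

lemma inj_weight: "inj (weight u)"
  by (rule injI) (metis signed_image_weight of_nat_eq_iff)

text \<open>Opposite positions carry opposite letters, so two positive letters never sit at opposite
  positions. Hence the sum of two weights is either strictly negative or strictly positive.\<close>

lemma weight_add_nonzero:
  assumes "i \<in> {1..n}" "j \<in> {1..n}"
  shows "weight u i + weight u j \<noteq> 0"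
proof
  assume "weight u i + weight u j = 0"
  then have "weight u i = - weight u j" by simp
  then have "int i = - int j"
    using signed_uminus[OF weight_in[OF assms(2)]] signed_image_weight by metis
  then show False using assms by auto
qed

lemma set_east_positions: "set (east_positions n u) = weight u ` {1..n}"
proof -
  have "set (east_positions n u) = {k \<in> {- int n..int n} - {0}. u k > 0}"
    unfolding east_positions_def set_filter set_indices ..
  also have "\<dots> = weight u ` {1..n}"
  proof (intro equalityI subsetI)
    fix k assume k: "k \<in> {k \<in> {- int n..int n} - {0}. u k > 0}"
    then have "u k \<in> {- int n..int n} - {0}"
      using permutes_in_image[OF signed_permutes] by blast
    then have "nat (u k) \<in> {1..n}" using k by simp linarith
    moreover have "k = weight u (nat (u k))"
      using k permutes_inverses(2)[OF signed_permutes] by (simp add: weight_def)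
    ultimately show "k \<in> weight u ` {1..n}" by (rule rev_image_eqI)
  next
    fix k assume "k \<in> weight u ` {1..n}"
    then obtain i where "i \<in> {1..n}" "k = weight u i" by (rule imageE)
    then show "k \<in> {k \<in> {- int n..int n} - {0}. u k > 0}"
      using weight_in[of i] by (simp add: signed_image_weight)
  qed
  finally show ?thesis .
qed

lemma sorted_east_positions: "sorted_wrt (<) (east_positions n u)"
  unfolding east_positions_def by (rule sorted_wrt_filter[OF sorted_indices])

lemma length_east_positions: "length (east_positions n u) = n"
proof -
  have "distinct (east_positions n u)"
    using sorted_east_positions by (simp add: strict_sorted_iff)
  then have "length (east_positions n u) = card (weight u ` {1..n})"
    using set_east_positions distinct_card by metis
  also have "\<dots> = n"
    by (simp add: card_image inj_on_subset[OF inj_weight])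
  finally show ?thesis .
qed

lemma lam_eq: "lam n u = map (\<lambda>k. nat (u k)) (east_positions n u)"
  by (simp add: lam_def full_notation_def east_positions_def filter_map o_def del: map_append filter_append)

lemma map_weight_lam: "map (weight u) (lam n u) = east_positions n u"
proof -
  have "weight u (nat (u k)) = k" if "k \<in> set (east_positions n u)" for k
  proof -
    obtain i where "k = weight u i" using \<open>k \<in> _\<close> set_east_positions by auto
    then show ?thesis by (simp add: signed_image_weight)
  qed
  then show ?thesis by (simp add: lam_eq o_def map_idI)
qed

lemma set_lam: "set (lam n u) = {1..n}"
proof -
  have "set (lam n u) = (\<lambda>i. nat (u (weight u i))) ` {1..n}"
    by (simp add: lam_eq set_east_positions image_image)
  then show ?thesis by (simp add: signed_image_weight)
qed

lemma sorted_lam: "sorted_wrt (\<lambda>i j. weight u i < weight u j) (lam n u)"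
  using sorted_east_positions unfolding map_weight_lam[symmetric] sorted_wrt_map .

lemma length_lam: "length (lam n u) = n"
  by (simp add: lam_eq length_east_positions)

lemma distinct_lam: "distinct (lam n u)"
  using set_lam length_lam by (intro card_distinct) simp

text \<open>This is the reflection symmetry of the path: negating a position exchanges South steps
  after \<open>b\<close> with East steps before \<open>- b\<close>.\<close>

lemma card_south_after:
  "card {j \<in> {- int n..int n} - {0}. \<not> u j > 0 \<and> b < j}
     = card {k \<in> {- int n..int n} - {0}. u k > 0 \<and> k < - b}"
proof -
  \<comment> \<open>A South position only yields \<open>\<not> u j > 0\<close>; excluding the letter
    0 makes \<open>u j\<close> negative, so that its mirror image is an East position.\<close>
  have nz: "u k \<noteq> 0" if "k \<in> {- int n..int n} - {0}" for k
    using permutes_in_image[OF signed_permutes] that by blast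
  have "{k \<in> {- int n..int n} - {0}. u k > 0 \<and> k < - b}
      = uminus ` {j \<in> {- int n..int n} - {0}. \<not> u j > 0 \<and> b < j}" (is "?A = uminus ` ?B")
  proof (intro equalityI subsetI)
    fix k assume k: "k \<in> ?A"
    then have "u (- k) = - u k" by (intro signed_uminus) simp
    then have "- k \<in> ?B" using k by simp
    moreover have "k = - (- k)" by simp
    ultimately show "k \<in> uminus ` ?B" by (rule rev_image_eqI)
  next
    fix k assume "k \<in> uminus ` ?B"
    then obtain j where j: "j \<in> ?B" "k = - j" by (rule imageE)
    then have "u (- j) = - u j" "u j \<noteq> 0" by (auto intro!: signed_uminus nz)
    then show "k \<in> ?A" using j by simp
  qed
  then show ?thesis by (simp add: card_image)
qed

text \<open>The South steps remaining after an East step are counted by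
  \<open>east_heights_map\<close> and then reflected into East steps by
  \<open>card_south_after\<close>, so heights are expressed by East positions alone.\<close>

lemma east_heights_path:
  assumes "x < n"
  shows "east_heights n (path_of n u) ! x
       = length (filter (\<lambda>b. b < - (east_positions n u ! x)) (east_positions n u))"
proof -
  have d: "distinct (indices n)"
    using sorted_indices strict_sorted_iff by blast
  \<comment> \<open>Of the \<open>2 * n\<close> positions exactly \<open>n\<close> are East, so the
    starting height \<open>n\<close> is the number of South steps that
    \<open>east_heights_map\<close> demands.\<close>
  have "length (filter (\<lambda>k. \<not> u k > 0) (indices n)) = n"
    using sum_length_filter_compl[of "\<lambda>k. u k > 0" "indices n"] length_east_positions
    unfolding east_positions_def by simp
  then have "east_heights n (path_of n u)
      = map (\<lambda>k. length (filter (\<lambda>j. \<not> u j > 0 \<and> k < j) (indices n))) (east_positions n u)"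
    using east_heights_map[OF sorted_indices, of "\<lambda>k. u k > 0" n]
    unfolding path_of_def full_notation_def east_positions_def map_map o_def by argo
  then have "east_heights n (path_of n u) ! x
      = length (filter (\<lambda>j. \<not> u j > 0 \<and> east_positions n u ! x < j) (indices n))"
    using assms length_east_positions by simp
  also have "\<dots> = card {j \<in> {- int n..int n} - {0}. \<not> u j > 0 \<and> east_positions n u ! x < j}"
    unfolding distinct_length_filter[OF d] set_indices by (rule arg_cong[of _ _ card]) blast
  also have "\<dots> = length (filter (\<lambda>b. b < - (east_positions n u ! x)) (east_positions n u))"
    unfolding card_south_after east_positions_def filter_filter
      distinct_length_filter[OF d] set_indices by (rule arg_cong[of _ _ card]) blast
  finally show ?thesis .
qed

text \<open>The height of column \<open>x\<close> counts the East positions below the negative of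
  the \<open>x\<close>-th one. It is at least \<open>y\<close> exactly when the \<open>y\<close>-th
  East position is among them, which is the sign condition on the sum.\<close>

lemma cell_below_iff:
  assumes "x \<in> {1..n}" "y \<in> {1..n}"
  shows "cell_below n u x y \<longleftrightarrow> weight u (lam n u ! (x - 1)) + weight u (lam n u ! (y - 1)) < 0"
proof -
  have w: "weight u (lam n u ! z) = east_positions n u ! z" if "z < n" for z
    using map_weight_lam length_lam that by (metis nth_map)
  have "cell_below n u x y \<longleftrightarrow> y - 1 < east_heights n (path_of n u) ! (x - 1)"
    using assms by (auto simp: cell_below_def)
  also have "\<dots> \<longleftrightarrow> east_positions n u ! (y - 1) < - (east_positions n u ! (x - 1))"
    using assms east_heights_path[of "x - 1"] length_east_positions
      nth_less_iff_length_filter[OF sorted_east_positions, of "y - 1"] by auto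
  finally show ?thesis using assms w[of "x - 1"] w[of "y - 1"] by auto
qed

lemma lam_inv:
  assumes "i \<in> {1..n}"
  shows "lam_inv n u i \<in> {1..n}" "lam n u ! (lam_inv n u i - 1) = i"
proof -
  obtain z where "z < n" "lam n u ! z = i"
    using assms set_lam length_lam by (metis in_set_conv_nth)
  then have "i \<in> (\<lambda>x. lam n u ! (x - 1)) ` {1..n}"
    by (intro image_eqI[of _ _ "Suc z"]) auto
  then show "lam_inv n u i \<in> {1..n}" "lam n u ! (lam_inv n u i - 1) = i"
    unfolding lam_inv_def by (rule inv_into_into, rule f_inv_into_f)
qed

lemma edges_of_eq:
  "edges_of n u = {{i, j} | i j. i \<in> {1..n} \<and> j \<in> {1..n} \<and> i \<noteq> j \<and> weight u i + weight u j < 0}"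
proof -
  have "cell_below n u (lam_inv n u i) (lam_inv n u j) \<longleftrightarrow> weight u i + weight u j < 0"
    if "i \<in> {1..n}" "j \<in> {1..n}" for i j
    using that by (simp only: cell_below_iff lam_inv)
  then show ?thesis unfolding edges_of_def by blast
qed

lemma edge_iff:
  assumes "i \<in> {1..n}" "j \<in> {1..n}" "i \<noteq> j"
  shows "{i, j} \<in> edges_of n u \<longleftrightarrow> weight u i + weight u j < 0"
  using assms unfolding edges_of_eq by (auto simp: doubleton_eq_iff add.commute)

text \<open>A letter \<open>- j\<close> at a positive position \<open>i\<close> means that
  \<open>j\<close> sits at position \<open>- i\<close>. Evenness thus becomes a condition on the
  number of negative weights, that is, of diagonal cells below the path.\<close>

lemma card_negative:
  "card {i \<in> {1..int n}. u i < 0} = card {i \<in> {1..n}. weight u i < 0}"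
proof (rule bij_betw_same_card[of "\<lambda>i. nat (- u i)"], rule bij_betw_byWitness[of _ "\<lambda>i. - weight u i"])
  have *: "weight u (nat (- u i)) = - i" "nat (- u i) \<in> {1..n}" if "i \<in> {1..int n}" "u i < 0" for i
  proof -
    have i: "i \<in> {- int n..int n} - {0}" using that by auto
    then have "u i \<in> {- int n..int n} - {0}" using permutes_in_image[OF signed_permutes] by blast
    then show "nat (- u i) \<in> {1..n}" using that by auto
    have "int (nat (- u i)) = u (- i)" using that signed_uminus[OF i] by simp
    then show "weight u (nat (- u i)) = - i"
      by (simp add: weight_def permutes_inverses(2)[OF signed_permutes])
  qed
  have **: "u (- weight u i) = - int i" "- weight u i \<in> {1..int n}"
    if "i \<in> {1..n}" "weight u i < 0" for i
    using weight_in[OF that(1)] that signed_uminus signed_image_weight by auto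
  show "\<forall>i \<in> {i \<in> {1..int n}. u i < 0}. - weight u (nat (- u i)) = i"
    using * by auto
  show "\<forall>i \<in> {i \<in> {1..n}. weight u i < 0}. nat (- u (- weight u i)) = i"
    using ** by auto
  show "(\<lambda>i. nat (- u i)) ` {i \<in> {1..int n}. u i < 0} \<subseteq> {i \<in> {1..n}. weight u i < 0}"
    using * by auto
  show "(\<lambda>i. - weight u i) ` {i \<in> {1..n}. weight u i < 0} \<subseteq> {i \<in> {1..int n}. u i < 0}"
    using ** by auto
qed

end

section \<open>Reconstruction of signed permutations from their weights\<close>

lemma signed_perm_eqI:
  assumes u: "u \<in> signed_perms n" and v: "v \<in> signed_perms n"
    and eq: "\<And>i. i \<in> {1..n} \<Longrightarrow> weight u i = weight v i"
  shows "u = v"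
proof -
  have "inv u k = inv v k" for k
  proof (cases "k \<in> {- int n..int n} - {0}")
    case True
    have pos: "inv u l = inv v l" if "l \<in> {1..int n}" for l
    proof -
      have "nat l \<in> {1..n}" "int (nat l) = l" using that by auto
      then show ?thesis using eq[of "nat l"] by (simp add: weight_def)
    qed
    show ?thesis
    proof (cases "k > 0")
      case True
      then show ?thesis using pos \<open>k \<in> _\<close> by simp
    next
      case False
      then have "inv u (- k) = inv v (- k)" using pos \<open>k \<in> _\<close> by simp
      then show ?thesis
        using signed_inv_uminus[OF u True] signed_inv_uminus[OF v True] by simp
    qed
  next
    case False
    then show ?thesis
      using permutes_inv[OF signed_permutes[OF u]] permutes_inv[OF signed_permutes[OF v]]
      by (metis permutes_not_in)
  qed
  then have "inv u = inv v" by (rule ext)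
  then show ?thesis
    by (metis permutes_inv_inv signed_permutes u v)
qed

text \<open>The inverse of the wanted permutation is the odd extension \<open>v\<close> of
  \<open>g\<close>. It is injective because \<open>g\<close> is and because no two values of
  \<open>g\<close> are opposite, hence it permutes the finite set of positions.\<close>

lemma signed_perm_of_weights:
  fixes g :: "nat \<Rightarrow> int"
  assumes range: "\<And>i. i \<in> {1..n} \<Longrightarrow> g i \<in> {- int n..int n} - {0}"
    and inj: "inj_on g {1..n}"
    and nonzero: "\<And>i j. i \<in> {1..n} \<Longrightarrow> j \<in> {1..n} \<Longrightarrow> g i + g j \<noteq> 0"
  shows "\<exists>u \<in> signed_perms n. \<forall>i \<in> {1..n}. weight u i = g i"
proof -
  let ?I = "{- int n..int n} - {0}"
  define v where "v k = (if k \<in> ?I then sgn k * g (nat \<bar>k\<bar>) else k)" for k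
  have in_range: "nat \<bar>k\<bar> \<in> {1..n}" if "k \<in> ?I" for k using that by auto
  have v_in: "v k \<in> ?I" if "k \<in> ?I" for k
    using range[OF in_range[OF that]] that by (auto simp: v_def sgn_if)
  have "inj_on v ?I"
  proof (rule inj_onI)
    fix k l assume k: "k \<in> ?I" and l: "l \<in> ?I" and "v k = v l"
    then have eq: "sgn k * g (nat \<bar>k\<bar>) = sgn l * g (nat \<bar>l\<bar>)" by (simp add: v_def)
    \<comment> \<open>With different signs the two values of \<open>g\<close> would be opposite and
      sum to 0.\<close>
    have "sgn k = sgn l"
      using eq nonzero[OF in_range[OF k] in_range[OF l]] k l by (auto simp: sgn_if split: if_splits)
    moreover from this eq have "g (nat \<bar>k\<bar>) = g (nat \<bar>l\<bar>)" using k by (auto simp: sgn_if split: if_splits)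
    then have "nat \<bar>k\<bar> = nat \<bar>l\<bar>" using inj_onD[OF inj] in_range k l by blast
    ultimately show "k = l" by (auto simp: sgn_if split: if_splits)
  qed
  moreover from this v_in have "v ` ?I = ?I" by (intro endo_inj_surj) auto
  ultimately have v: "v permutes ?I"
    by (intro bij_imp_permutes) (auto simp: bij_betw_def v_def)
  have v_uminus: "v (- k) = - v k" for k by (auto simp: v_def)
  have "inv v (- k) = - inv v k" for k
    using v_uminus permutes_inverses[OF v] by metis
  then have "inv v \<in> signed_perms n"
    using permutes_inv[OF v] by (simp add: signed_perms_def)
  moreover have "weight (inv v) i = g i" if "i \<in> {1..n}" for i
    using that by (simp add: weight_def permutes_inv_inv[OF v] v_def)
  ultimately show ?thesis by blast
qed

text \<open>The weights along \<open>xs\<close> and along \<open>lam n u\<close> are strictly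
  increasing lists with the same entries, hence equal, and \<open>weight u\<close> is
  injective.\<close>

lemma lam_eqI:
  assumes u: "u \<in> signed_perms n" and xs: "set xs = {1..n}"
    and sorted: "sorted_wrt (\<lambda>i j. weight u i < weight u j) xs"
  shows "lam n u = xs"
proof -
  have "map (weight u) xs = map (weight u) (lam n u)"
    by (rule strict_sorted_equal)
      (use u xs sorted in \<open>simp_all add: sorted_wrt_map sorted_lam set_lam\<close>)
  then show ?thesis
    using inj_weight[OF u] by (metis inj_map_eq_map)
qed

section \<open>Threshold graphs\<close>

lemma simple_graph_no_loop:
  assumes "simple_graph (V, E)"
  shows "{x} \<notin> E"
proof
  assume "{x} \<in> E"
  then have "card {x} = 2" using assms unfolding simple_graph_def snd_conv by blast
  then show False by simp
qed

text \<open>The embedding \<open>g\<close> is the inverse of the isomorphism from the induced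
  subgraph. It reduces induced copies to adjacency of pairs; pairs with \<open>i = j\<close> are
  harmless, as a singleton is never an edge.\<close>

lemma has_induced_iff:
  assumes G: "simple_graph (V, E)" and H: "simple_graph (W, F)"
  shows "has_induced (V, E) (W, F) \<longleftrightarrow>
    (\<exists>g. inj_on g W \<and> g ` W \<subseteq> V \<and> (\<forall>i\<in>W. \<forall>j\<in>W. {g i, g j} \<in> E \<longleftrightarrow> {i, j} \<in> F))"
    (is "_ \<longleftrightarrow> ?R")
proof
  assume "has_induced (V, E) (W, F)"
  then obtain S f where S: "S \<subseteq> V" and f: "bij_betw f S W"
    and F: "(\<lambda>e. f ` e) ` {e \<in> E. e \<subseteq> S} = F"
    by (auto simp: has_induced_def graph_iso_def induced_subgraph_def)
  define g where "g = inv_into S f"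
  have g: "bij_betw g W S" unfolding g_def by (rule bij_betw_inv_into[OF f])
  have fg: "f (g i) = i" if "i \<in> W" for i
    unfolding g_def using bij_betw_inv_into_right[OF f that] .
  have gf: "g ` f ` e = e" if "e \<subseteq> S" for e
    unfolding g_def using inv_into_image_cancel[OF bij_betw_imp_inj_on[OF f] that] .
  have "{g i, g j} \<in> E \<longleftrightarrow> {i, j} \<in> F" if ij: "i \<in> W" "j \<in> W" for i j
  proof
    assume "{g i, g j} \<in> E"
    moreover have "{g i, g j} \<subseteq> S" using bij_betwE[OF g] ij by blast
    ultimately have "f ` {g i, g j} \<in> F" using F by blast
    then show "{i, j} \<in> F" using fg ij by simp
  next
    assume "{i, j} \<in> F"
    then obtain e where e: "e \<in> E" "e \<subseteq> S" "{i, j} = f ` e" using F by blast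
    then have "g ` {i, j} = e" using gf by metis
    then show "{g i, g j} \<in> E" using e(1) by simp
  qed
  then show ?R using g S by (auto simp: bij_betw_def)
next
  assume ?R
  then obtain g where inj: "inj_on g W" and V: "g ` W \<subseteq> V"
    and EF: "\<And>i j. i \<in> W \<Longrightarrow> j \<in> W \<Longrightarrow> {g i, g j} \<in> E \<longleftrightarrow> {i, j} \<in> F"
    by blast
  define f where "f = inv_into W g"
  have f: "bij_betw f (g ` W) W"
    unfolding f_def by (rule bij_betw_inv_into) (simp add: inj bij_betw_def)
  have fg: "f (g i) = i" if "i \<in> W" for i
    unfolding f_def using inv_into_f_f[OF inj that] .
  have "(\<lambda>e. f ` e) ` {e \<in> E. e \<subseteq> g ` W} = F"
  proof (intro equalityI subsetI)
    fix p assume "p \<in> (\<lambda>e. f ` e) ` {e \<in> E. e \<subseteq> g ` W}"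
    then obtain e where e: "e \<in> E" "e \<subseteq> g ` W" "p = f ` e" by blast
    then have "card e = 2" using G by (auto simp: simple_graph_def)
    then obtain i j where "i \<in> W" "j \<in> W" "e = {g i, g j}"
      using e(2) by (auto simp: card_2_iff)
    then show "p \<in> F" using e EF fg by simp
  next
    fix p assume p: "p \<in> F"
    then have "card p = 2" "p \<subseteq> W" using H by (auto simp: simple_graph_def)
    then obtain i j where ij: "i \<in> W" "j \<in> W" "p = {i, j}" by (auto simp: card_2_iff)
    then have "{g i, g j} \<in> {e \<in> E. e \<subseteq> g ` W}" "p = f ` {g i, g j}"
      using EF fg p by auto
    then show "p \<in> (\<lambda>e. f ` e) ` {e \<in> E. e \<subseteq> g ` W}" by blast
  qed
  then show "has_induced (V, E) (W, F)"
    using f V by (auto simp: has_induced_def graph_iso_def induced_subgraph_def)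
qed

text \<open>The diagonals \<open>{a, c}\<close> and \<open>{b, d}\<close> are deliberately left
  free: their four possible states produce the three forbidden graphs.\<close>

definition alternating_cycle :: "'a set set \<Rightarrow> 'a \<Rightarrow> 'a \<Rightarrow> 'a \<Rightarrow> 'a \<Rightarrow> bool" where
  "alternating_cycle E a b c d \<longleftrightarrow>
     distinct [a, b, c, d] \<and> {a, b} \<in> E \<and> {b, c} \<notin> E \<and> {c, d} \<in> E \<and> {d, a} \<notin> E"

lemma simple_graph_patterns:
  "simple_graph two_K2" "simple_graph path_P4" "simple_graph cycle_C4"
  by (auto simp: simple_graph_def two_K2_def path_P4_def cycle_C4_def)

text \<open>An alternating cycle induces \<open>cycle_C4\<close>, \<open>path_P4\<close> or
  \<open>two_K2\<close> according to whether two, one or none of its diagonals are edges. Conversely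
  each of these graphs contains an alternating cycle, and an induced copy carries it along.\<close>

lemma threshold_graph_iff:
  assumes G: "simple_graph (V, E)"
  shows "threshold_graph (V, E) \<longleftrightarrow> (\<forall>a b c d. \<not> alternating_cycle E a b c d)"
proof (intro iffI allI notI)
  fix a b c d
  assume thr: "threshold_graph (V, E)" and alt: "alternating_cycle E a b c d"
  have V: "{a, b, c, d} \<subseteq> V"
  proof -
    have "{a, b} \<in> E" "{c, d} \<in> E" using alt by (simp_all add: alternating_cycle_def)
    then have "{a, b} \<subseteq> V" "{c, d} \<subseteq> V"
      using G unfolding simple_graph_def snd_conv fst_conv by blast+
    then show ?thesis by simp
  qed
  note noloop = simple_graph_no_loop[OF G]
  have ind: "has_induced (V, E) ({1, 2, 3, 4}, F)"
    if "simple_graph ({1, 2, 3, 4::nat}, F)" "distinct [p, q, r, s]" "{p, q, r, s} \<subseteq> V"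
      "{p, q} \<in> E \<longleftrightarrow> {1, 2} \<in> F" "{p, r} \<in> E \<longleftrightarrow> {1, 3} \<in> F" "{p, s} \<in> E \<longleftrightarrow> {1, 4} \<in> F"
      "{q, r} \<in> E \<longleftrightarrow> {2, 3} \<in> F" "{q, s} \<in> E \<longleftrightarrow> {2, 4} \<in> F" "{r, s} \<in> E \<longleftrightarrow> {3, 4} \<in> F"
    for F p q r s
  proof -
    define g where "g i = (if i = 1 then p else if i = 2 then q else if i = 3 then r else s)" for i :: nat
    have g: "g (Suc 0) = p" "g 2 = q" "g 3 = r" "g 4 = s" by (simp_all add: g_def)
    note F = simple_graph_no_loop[OF that(1)]
    have "inj_on g {1, 2, 3, 4}" "g ` {1, 2, 3, 4} \<subseteq> V"
      using that(2,3) by (simp_all add: g)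
    moreover have "\<forall>i\<in>{1, 2, 3, 4}. \<forall>j\<in>{1, 2, 3, 4}. {g i, g j} \<in> E \<longleftrightarrow> {i, j} \<in> F"
      using that(4-9) noloop F by (simp add: g insert_commute)
    ultimately show ?thesis
      unfolding has_induced_iff[OF G that(1)] by (intro exI[of _ g] conjI)
  qed
  note patterns = simple_graph_patterns[unfolded two_K2_def path_P4_def cycle_C4_def]
  note alt = alt[unfolded alternating_cycle_def]
  show False
  proof (cases "{a, c} \<in> E"; cases "{b, d} \<in> E")
    assume "{a, c} \<in> E" "{b, d} \<in> E"
    then have "has_induced (V, E) cycle_C4" unfolding cycle_C4_def
      using alt V by (intro ind[OF patterns(3), of b a c d]) (auto simp: insert_commute doubleton_eq_iff)
    then show False using thr by (simp add: threshold_graph_def)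
  next
    assume "{a, c} \<in> E" "{b, d} \<notin> E"
    then have "has_induced (V, E) path_P4" unfolding path_P4_def
      using alt V by (intro ind[OF patterns(2), of b a c d]) (auto simp: insert_commute doubleton_eq_iff)
    then show False using thr by (simp add: threshold_graph_def)
  next
    assume "{a, c} \<notin> E" "{b, d} \<in> E"
    then have "has_induced (V, E) path_P4" unfolding path_P4_def
      using alt V by (intro ind[OF patterns(2), of a b d c]) (auto simp: insert_commute doubleton_eq_iff)
    then show False using thr by (simp add: threshold_graph_def)
  next
    assume "{a, c} \<notin> E" "{b, d} \<notin> E"
    then have "has_induced (V, E) two_K2" unfolding two_K2_def
      using alt V by (intro ind[OF patterns(1), of a b c d]) (auto simp: insert_commute doubleton_eq_iff)
    then show False using thr by (simp add: threshold_graph_def)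
  qed
next
  assume no: "\<forall>a b c d. \<not> alternating_cycle E a b c d"
  have copy: "\<exists>a b c d. alternating_cycle E a b c d"
    if "has_induced (V, E) (W, F)" "simple_graph (W, F)" "alternating_cycle F a b c d" "{a, b, c, d} \<subseteq> W"
    for W F and a b c d :: 'b
  proof -
    from that(1)[unfolded has_induced_iff[OF G that(2)]] obtain g
      where inj: "inj_on g W" and g: "\<forall>i\<in>W. \<forall>j\<in>W. {g i, g j} \<in> E \<longleftrightarrow> {i, j} \<in> F"
      by (elim exE conjE)
    have "distinct (map g [a, b, c, d])"
      unfolding distinct_map using that(3) inj_on_subset[OF inj that(4)]
      by (simp add: alternating_cycle_def)
    then have "alternating_cycle E (g a) (g b) (g c) (g d)"
      using that(3,4) g unfolding alternating_cycle_def by simp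
    then show ?thesis by blast
  qed
  note patterns = simple_graph_patterns[unfolded two_K2_def path_P4_def cycle_C4_def]
  show "threshold_graph (V, E)"
    unfolding threshold_graph_def two_K2_def path_P4_def cycle_C4_def
  proof (intro conjI G notI)
    assume *: "has_induced (V, E) ({1, 2, 3, 4::nat}, {{1, 2}, {3, 4}})"
    have "alternating_cycle {{1, 2}, {3, 4}} 1 2 3 (4::nat)"
      by (simp add: alternating_cycle_def doubleton_eq_iff)
    from copy[OF * patterns(1) this] no show False by simp
  next
    assume *: "has_induced (V, E) ({1, 2, 3, 4::nat}, {{1, 2}, {2, 3}, {3, 4}})"
    \<comment> \<open>The order 1, 2, 4, 3 uses the outer edges of the path and makes its middle
      edge a diagonal.\<close>
    have "alternating_cycle {{1, 2}, {2, 3}, {3, 4}} 1 2 4 (3::nat)"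
      by (simp add: alternating_cycle_def doubleton_eq_iff)
    from copy[OF * patterns(2) this] no show False by simp
  next
    assume *: "has_induced (V, E) ({1, 2, 3, 4::nat}, {{1, 2}, {2, 3}, {3, 4}, {4, 1}})"
    have "alternating_cycle {{1, 2}, {2, 3}, {3, 4}, {4, 1}} 1 2 4 (3::nat)"
      by (simp add: alternating_cycle_def doubleton_eq_iff)
    from copy[OF * patterns(3) this] no show False by simp
  qed
qed

section \<open>Degrees and nested neighbourhoods\<close>

lemma degree_eq_card_neighbours:
  assumes "simple_graph (V, E)"
  shows "degree E v = card {x \<in> V. {v, x} \<in> E}"
proof -
  have "{e \<in> E. v \<in> e} = (\<lambda>x. {v, x}) ` {x \<in> V. {v, x} \<in> E}"
  proof (intro equalityI subsetI)
    fix e assume e: "e \<in> {e \<in> E. v \<in> e}"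
    then have "card e = 2" "e \<subseteq> V" using assms by (auto simp: simple_graph_def)
    then obtain x where "e = {v, x}" using e by (auto simp: card_2_iff)
    then show "e \<in> (\<lambda>x. {v, x}) ` {x \<in> V. {v, x} \<in> E}" using e \<open>e \<subseteq> V\<close> by auto
  qed auto
  moreover have "inj_on (\<lambda>x. {v, x}) {x \<in> V. {v, x} \<in> E}"
    by (auto simp: inj_on_def doubleton_eq_iff)
  ultimately show ?thesis by (simp add: degree_def card_image)
qed

text \<open>When \<open>i\<close> and \<open>j\<close> are adjacent, \<open>i\<close> is a neighbour
  of \<open>j\<close> but not of itself, so plain inclusion of neighbourhoods fails; exchanging the
  two vertices repairs exactly this.\<close>

lemma transpose_neighbours:
  assumes "simple_graph (V, E)" "i \<in> V" "j \<in> V"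
    and "\<And>x. x \<in> V \<Longrightarrow> x \<noteq> i \<Longrightarrow> x \<noteq> j \<Longrightarrow> {j, x} \<in> E \<Longrightarrow> {i, x} \<in> E"
  shows "transpose i j ` {x \<in> V. {j, x} \<in> E} \<subseteq> {x \<in> V. {i, x} \<in> E}"
proof -
  have "{j} \<notin> E" by (rule simple_graph_no_loop[OF assms(1)])
  then show ?thesis
    using assms by (auto simp: transpose_def insert_commute)
qed

lemma degree_mono:
  assumes "simple_graph (V, E)" "finite V" "i \<in> V" "j \<in> V"
    and "\<And>x. x \<in> V \<Longrightarrow> x \<noteq> i \<Longrightarrow> x \<noteq> j \<Longrightarrow> {j, x} \<in> E \<Longrightarrow> {i, x} \<in> E"
  shows "degree E j \<le> degree E i"
  unfolding degree_eq_card_neighbours[OF assms(1)]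
  by (rule card_inj_on_le[OF _ transpose_neighbours[OF assms(1,3,4,5)]])
    (use assms in \<open>auto intro: inj_on_subset[OF inj_transpose]\<close>)

text \<open>If \<open>x\<close> were adjacent to \<open>j\<close> only, then by the degrees some
  \<open>y\<close> would be adjacent to \<open>i\<close> only, and \<open>i\<close>,
  \<open>y\<close>, \<open>j\<close>, \<open>x\<close> would form an alternating cycle.\<close>

lemma threshold_neighbours_nested:
  assumes thr: "threshold_graph (V, E)" and V: "finite V" "i \<in> V" "j \<in> V"
    and deg: "degree E j \<le> degree E i"
    and x: "x \<noteq> i" "x \<noteq> j" "{j, x} \<in> E"
  shows "{i, x} \<in> E"
proof (rule ccontr)
  assume nx: "{i, x} \<notin> E"
  have G: "simple_graph (V, E)" using thr by (simp add: threshold_graph_def)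
  have "x \<in> V" using G x by (auto simp: simple_graph_def)
  \<comment> \<open>Without such a \<open>y\<close>, the neighbourhood of \<open>i\<close>, with
    \<open>i\<close> and \<open>j\<close> exchanged, would lie inside that of \<open>j\<close> and
    miss \<open>x\<close>, so \<open>j\<close> would have the larger degree.\<close>
  have "\<exists>y \<in> V. y \<noteq> i \<and> y \<noteq> j \<and> {i, y} \<in> E \<and> {j, y} \<notin> E"
  proof (rule ccontr)
    assume *: "\<not> ?thesis"
    have "transpose j i ` {y \<in> V. {i, y} \<in> E} \<subseteq> {y \<in> V. {j, y} \<in> E}"
      using * by (intro transpose_neighbours[OF G V(3,2)]) blast
    moreover have "x \<notin> transpose j i ` {y \<in> V. {i, y} \<in> E}"
      using x nx by (auto simp: transpose_def split: if_splits)
    ultimately have "transpose j i ` {y \<in> V. {i, y} \<in> E} \<subset> {y \<in> V. {j, y} \<in> E}"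
      using x \<open>x \<in> V\<close> by blast
    then have "card (transpose j i ` {y \<in> V. {i, y} \<in> E}) < card {y \<in> V. {j, y} \<in> E}"
      using V by (intro psubset_card_mono) auto
    then show False
      using deg by (simp add: degree_eq_card_neighbours[OF G] card_image inj_on_subset[OF inj_transpose])
  qed
  then obtain y where y: "y \<noteq> i" "y \<noteq> j" "{i, y} \<in> E" "{j, y} \<notin> E" by blast
  have "i \<noteq> j" using x nx by blast
  then have "alternating_cycle E i y j x"
    using x y nx by (auto simp: alternating_cycle_def insert_commute)
  then show False using thr threshold_graph_iff[OF G] by blast
qed

section \<open>Injectivity\<close>

text \<open>Both comparisons are the comparison of places in \<open>xs\<close>.\<close>

lemma sorted_wrt_less_iff:
  fixes f :: "'a \<Rightarrow> 'b::linorder" and g :: "'a \<Rightarrow> 'c::linorder"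
  assumes "sorted_wrt (\<lambda>i j. f i < f j) xs" "sorted_wrt (\<lambda>i j. g i < g j) xs"
    and "i \<in> set xs" "j \<in> set xs"
  shows "f i < f j \<longleftrightarrow> g i < g j"
proof -
  obtain a b where ab: "a < length xs" "i = xs ! a" "b < length xs" "j = xs ! b"
    using assms(3,4) by (metis in_set_conv_nth)
  note step = sorted_wrt_nth_less[OF assms(1)] sorted_wrt_nth_less[OF assms(2)]
  show ?thesis
  proof (cases a b rule: linorder_cases)
    case less
    then show ?thesis using ab step by simp
  next
    case greater
    then have "f j < f i" "g j < g i" using ab step by simp_all
    then show ?thesis by (simp add: less_not_sym)
  qed (use ab in simp)
qed

text \<open>Every position is \<open>weight u j\<close> or \<open>- weight u j\<close> for exactly one \<open>j\<close>, so the number of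
  positions before \<open>weight u i\<close> depends only on how weights compare and on the signs of sums.\<close>

lemma card_positions_before_weight:
  assumes u: "u \<in> signed_perms n" and i: "i \<in> {1..n}"
  shows "card {k \<in> {- int n..int n} - {0}. k < weight u i}
       = card {j \<in> {1..n}. weight u j < weight u i}
       + card {j \<in> {1..n}. \<not> weight u i + weight u j < 0}"
proof -
  let ?I = "{- int n..int n} - {0}"
  let ?A = "{j \<in> {1..n}. weight u j < weight u i}"
  let ?B = "{j \<in> {1..n}. \<not> weight u i + weight u j < 0}"
  have B: "- weight u j < weight u i \<longleftrightarrow> \<not> weight u i + weight u j < 0" if "j \<in> {1..n}" for j
    using weight_add_nonzero[OF u i that] by linarith
  have W: "weight u j \<in> ?I" "- weight u j \<in> ?I" if "j \<in> {1..n}" for j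
    using weight_in[OF u that] by auto
  have cover: "\<exists>j \<in> {1..n}. k = weight u j \<or> k = - weight u j" if k: "k \<in> ?I" for k
  proof -
    have I: "u k \<in> ?I" using permutes_in_image[OF signed_permutes[OF u]] k by blast
    then have j: "nat \<bar>u k\<bar> \<in> {1..n}" by auto
    have "weight u (nat \<bar>u k\<bar>) = inv u \<bar>u k\<bar>" by (simp add: weight_def)
    also have "\<dots> = k \<or> \<dots> = - k"
      using signed_inv_uminus[OF u I] permutes_inverses(2)[OF signed_permutes[OF u]]
      by (auto simp: abs_if)
    finally show ?thesis using j by (metis minus_minus)
  qed
  have "{k \<in> ?I. k < weight u i} = weight u ` ?A \<union> (\<lambda>j. - weight u j) ` ?B" (is "?L = ?R")
  proof (intro equalityI subsetI)
    fix k assume k: "k \<in> ?L"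
    then obtain j where "j \<in> {1..n}" "k = weight u j \<or> k = - weight u j"
      using cover by blast
    then show "k \<in> ?R" using B[of j] k by blast
  next
    fix k assume "k \<in> ?R"
    then obtain j where "j \<in> {1..n}"
      "k = weight u j \<and> weight u j < weight u i \<or> k = - weight u j \<and> \<not> weight u i + weight u j < 0"
      by blast
    then show "k \<in> ?L" using B[of j] W[of j] by auto
  qed
  moreover have "weight u ` ?A \<inter> (\<lambda>j. - weight u j) ` ?B = {}"
  proof (rule ccontr)
    assume "\<not> ?thesis"
    then obtain j k where "j \<in> {1..n}" "k \<in> {1..n}" "weight u j = - weight u k" by blast
    then show False using weight_add_nonzero[OF u, of j k] by simp
  qed
  moreover have "inj_on (weight u) ?A" "inj_on (\<lambda>j. - weight u j) ?B"
    using inj_weight[OF u] by (auto simp: inj_on_def inj_def)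
  ultimately show ?thesis by (simp add: card_Un_disjoint card_image)
qed

lemma weight_less_iff_of_lam_eq:
  assumes "u \<in> signed_perms n" "v \<in> signed_perms n" "lam n u = lam n v"
    and "i \<in> {1..n}" "j \<in> {1..n}"
  shows "weight u i < weight u j \<longleftrightarrow> weight v i < weight v j"
proof (rule sorted_wrt_less_iff)
  show "sorted_wrt (\<lambda>i j. weight u i < weight u j) (lam n u)"
    by (rule sorted_lam) fact
  show "sorted_wrt (\<lambda>i j. weight v i < weight v j) (lam n u)"
    unfolding assms(3) by (rule sorted_lam) fact
qed (use assms set_lam in simp_all)

text \<open>This is where evenness enters injectivity. The letters of negative weight form initial
  segments of the common word \<open>lam\<close>, so the two sets are nested. Their difference has
  even size, so if nonempty it contains two letters, which form an edge for \<open>u\<close> but not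
  for \<open>v\<close>.\<close>

lemma negative_weights_subset:
  assumes u: "u \<in> even_signed_perms n" and v: "v \<in> even_signed_perms n"
    and lam: "lam n u = lam n v" and edges: "edges_of n u = edges_of n v"
  shows "{i \<in> {1..n}. weight u i < 0} \<subseteq> {i \<in> {1..n}. weight v i < 0}" (is "?U \<subseteq> ?V")
proof (rule ccontr)
  assume "\<not> ?U \<subseteq> ?V"
  then obtain i where i: "i \<in> ?U" "i \<notin> ?V" by blast
  have su: "u \<in> signed_perms n" and sv: "v \<in> signed_perms n"
    using u v by (simp_all add: even_signed_perms_def)
  note less = weight_less_iff_of_lam_eq[OF su sv lam]
  have "?V \<subseteq> ?U"
  proof (rule ccontr)
    assume "\<not> ?V \<subseteq> ?U"
    then obtain j where "j \<in> ?V" "j \<notin> ?U" by blast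
    then show False using i less[of i j] by auto
  qed
  have "even (card ?U)" "even (card ?V)"
    using u v card_negative[OF su] card_negative[OF sv] by (simp_all add: even_signed_perms_def)
  then have "even (card (?U - ?V))"
    using \<open>?V \<subseteq> ?U\<close> by (simp add: card_Diff_subset card_mono)
  define D where "D = ?U - ?V"
  have "D \<noteq> {i}" using \<open>even (card (?U - ?V))\<close> unfolding D_def[symmetric] by auto
  moreover have "i \<in> D" unfolding D_def using i by (rule DiffI)
  ultimately obtain j where "j \<in> D" and ji: "j \<noteq> i" by blast
  then have j: "j \<in> ?U" "j \<notin> ?V" unfolding D_def by simp_all
  have ij: "i \<in> {1..n}" "j \<in> {1..n}" "i \<noteq> j" using i j ji by simp_all
  have "weight u i + weight u j < 0" "\<not> weight v i + weight v j < 0" using i j by simp_all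
  then show False
    using edge_iff[OF su ij] edge_iff[OF sv ij] edges by simp
qed

lemma lam_edges_inj: "inj_on (\<lambda>u. (lam n u, edges_of n u)) (even_signed_perms n)"
proof (rule inj_onI)
  fix u v assume u: "u \<in> even_signed_perms n" and v: "v \<in> even_signed_perms n"
    and "(lam n u, edges_of n u) = (lam n v, edges_of n v)"
  then have lam: "lam n u = lam n v" and edges: "edges_of n u = edges_of n v" by simp_all
  have su: "u \<in> signed_perms n" and sv: "v \<in> signed_perms n"
    using u v by (simp_all add: even_signed_perms_def)
  note less = weight_less_iff_of_lam_eq[OF su sv lam]
  \<comment> \<open>The edges do not see the diagonal sums \<open>2 * weight u k\<close>; their
    signs come from the preceding lemma, applied in both directions.\<close>
  have neg: "weight u k < 0 \<longleftrightarrow> weight v k < 0" if "k \<in> {1..n}" for k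
    using negative_weights_subset[OF u v lam edges]
      negative_weights_subset[OF v u lam[symmetric] edges[symmetric]] that by blast
  have sum: "weight u k + weight u l < 0 \<longleftrightarrow> weight v k + weight v l < 0"
    if "k \<in> {1..n}" "l \<in> {1..n}" for k l
  proof (cases "k = l")
    case True
    then show ?thesis using neg[of k] that by auto
  next
    case False
    then show ?thesis using edge_iff[OF su that] edge_iff[OF sv that] edges by simp
  qed
  show "u = v"
  proof (rule signed_perm_eqI[OF su sv])
    fix i assume i: "i \<in> {1..n}"
    let ?before = "\<lambda>c. {k \<in> {- int n..int n} - {0}. k < c}"
    have "card {j \<in> {1..n}. weight u j < weight u i} = card {j \<in> {1..n}. weight v j < weight v i}"
      using less i by (intro arg_cong[of _ _ card] Collect_cong) blast
    moreover have "card {j \<in> {1..n}. \<not> weight u i + weight u j < 0}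
        = card {j \<in> {1..n}. \<not> weight v i + weight v j < 0}"
      using sum i by (intro arg_cong[of _ _ card] Collect_cong) blast
    ultimately have eq: "card (?before (weight u i)) = card (?before (weight v i))"
      using card_positions_before_weight[OF su i] card_positions_before_weight[OF sv i] by simp
    \<comment> \<open>The number of earlier positions increases strictly along the positions, so it
      determines the weight.\<close>
    have mono: "card (?before c) < card (?before d)"
      if "c < d" "c \<in> {- int n..int n} - {0}" for c d
    proof (rule psubset_card_mono)
      show "finite (?before d)"
        by (rule finite_subset[of _ "{- int n..int n}"]) auto
      show "?before c \<subset> ?before d" using that by auto
    qed
    show "weight u i = weight v i"
      using mono[of "weight u i" "weight v i"] mono[of "weight v i" "weight u i"] eq
        weight_in[OF su i] weight_in[OF sv i] by linarith
  qed
qed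

section \<open>The image consists of threshold graphs with degree orderings\<close>

lemma simple_edges_of:
  assumes "u \<in> signed_perms n"
  shows "simple_graph ({1..n}, edges_of n u)"
  by (auto simp: simple_graph_def edges_of_eq[OF assms])

lemma lam_edges_in_TG:
  assumes u: "u \<in> signed_perms n"
  shows "(lam n u, edges_of n u) \<in> TG n"
proof -
  note G = simple_edges_of[OF u]
  have dom: "i \<in> {1..n} \<and> j \<in> {1..n}" if "{i, j} \<in> edges_of n u" for i j
    using G that unfolding simple_graph_def by auto
  have "threshold_graph ({1..n}, edges_of n u)"
    unfolding threshold_graph_iff[OF G]
  proof (intro allI notI)
    fix a b c d assume alt: "alternating_cycle (edges_of n u) a b c d"
    then have "a \<in> {1..n}" "b \<in> {1..n}" "c \<in> {1..n}" "d \<in> {1..n}"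
      using dom unfolding alternating_cycle_def by blast+
    with alt have "weight u a + weight u b < 0" "\<not> weight u b + weight u c < 0"
      "weight u c + weight u d < 0" "\<not> weight u d + weight u a < 0"
      using edge_iff[OF u] unfolding alternating_cycle_def by auto
    then show False by linarith
  qed
  moreover have "lam n u \<in> permutations_of_set {1..n}"
    using u by (simp add: permutations_of_set_def set_lam distinct_lam)
  \<comment> \<open>A letter of smaller weight makes more sums negative, so apart from the two
    letters themselves it has all neighbours of the other.\<close>
  moreover have "sorted_wrt (\<lambda>i j. degree (edges_of n u) i \<ge> degree (edges_of n u) j) (lam n u)"
  proof (rule sorted_wrt_mono_rel[OF _ sorted_lam[OF u]])
    fix i j assume "i \<in> set (lam n u)" "j \<in> set (lam n u)" and less: "weight u i < weight u j"
    then have ij: "i \<in> {1..n}" "j \<in> {1..n}" using set_lam[OF u] by auto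
    show "degree (edges_of n u) j \<le> degree (edges_of n u) i"
    proof (rule degree_mono[OF G _ ij])
      fix x assume x: "x \<in> {1..n}" "x \<noteq> i" "x \<noteq> j" "{j, x} \<in> edges_of n u"
      then show "{i, x} \<in> edges_of n u"
        using edge_iff[OF u, of j x] edge_iff[OF u, of i x] ij less by auto
    qed simp
  qed
  ultimately show ?thesis
    by (simp add: TG_def degree_ordering_def sorted_wrt_map)
qed

section \<open>Surjectivity\<close>

lemma downset_nat_eq_lessThan_card:
  fixes S :: "nat set"
  assumes "finite S" and down: "\<And>x y. x \<in> S \<Longrightarrow> y < x \<Longrightarrow> y \<in> S"
  shows "S = {..<card S}"
proof (rule set_eqI)
  fix y
  show "y \<in> S \<longleftrightarrow> y \<in> {..<card S}"
  proof
    assume "y \<in> S"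
    then have "{..y} \<subseteq> S" using down by (auto simp: le_less)
    then have "card {..y} \<le> card S" using assms(1) by (rule card_mono[rotated])
    then show "y \<in> {..<card S}" by simp
  next
    assume y: "y \<in> {..<card S}"
    show "y \<in> S"
    proof (rule ccontr)
      assume "y \<notin> S"
      then have "S \<subseteq> {..<y}" using down by (metis lessThan_iff linorder_neqE_nat subsetI)
      then have "card S \<le> card {..<y}" by (intro card_mono) auto
      then show False using y by simp
    qed
  qed
qed

text \<open>A symmetric Young diagram \<open>F\<close>, with rows and columns numbered from 0, is realised by
  placing its \<open>x\<close>-th East step at the position \<open>x\<close> minus the length of row \<open>x\<close>, shifted by one
  when this is nonnegative because position 0 does not exist.\<close>

lemma weights_of_symmetric_diagram:
  fixes F :: "nat \<Rightarrow> nat \<Rightarrow> bool"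
  assumes sym: "\<And>x y. F x y \<longleftrightarrow> F y x"
    and diagram: "\<forall>x<n. \<forall>y<n. \<forall>x'<x. F x y \<longrightarrow> F x' y"
  shows "\<exists>b :: nat \<Rightarrow> int.
      (\<forall>x<n. b x \<in> {- int n..int n} - {0}) \<and>
      (\<forall>y<n. \<forall>x<y. b x < b y) \<and>
      (\<forall>x<n. \<forall>y<n. F x y \<longleftrightarrow> b x + b y < 0) \<and>
      (\<forall>x<n. \<forall>y<n. b x + b y \<noteq> 0)"
proof -
  note down = diagram[rule_format]
  define row where "row x = {y. y < n \<and> F x y}" for x
  define h where "h x = card (row x)" for x
  define b where "b x = (let d = int x - int (h x) in if d < 0 then d else d + 1)" for x
  have row: "row x = {..<h x}" if "x < n" for x
    unfolding h_def
  proof (rule downset_nat_eq_lessThan_card)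
    show "finite (row x)" by (simp add: row_def)
    show "z \<in> row x" if "y \<in> row x" "z < y" for y z
      using down[of y x z] sym[of x] \<open>x < n\<close> that by (auto simp: row_def)
  qed
  have F_iff: "F x y \<longleftrightarrow> y < h x" if "x < n" "y < n" for x y
    using row[OF that(1)] that(2) by (auto simp: row_def)
  have h_le: "h x \<le> n" for x
    unfolding h_def row_def using card_mono[of "{..<n}" "{y. y < n \<and> F x y}"] by auto
  have h_antimono: "h y \<le> h x" if "x < y" "y < n" for x y
    unfolding h_def
  proof (rule card_mono)
    show "row y \<subseteq> row x" using down[of y _ x] that by (auto simp: row_def)
  qed (simp add: row_def)
  show ?thesis
  proof (intro exI[of _ b] conjI allI impI)
    \<comment> \<open>Since \<open>x < n\<close>, the shifted value \<open>x - h x + 1\<close> is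
      still at most \<open>n\<close>.\<close>
    show "b x \<in> {- int n..int n} - {0}" if "x < n" for x
      using h_le[of x] that by (auto simp: b_def Let_def)
    show "b x < b y" if "y < n" "x < y" for x y
      using h_antimono[OF that(2,1)] that by (auto simp: b_def Let_def)
    fix x y assume xy: "x < n" "y < n"
    \<comment> \<open>For a cell of \<open>F\<close> the two differences sum to at most -2 and at
      most one is shifted; for any other cell they sum to at least 0 and at least one is shifted. So
      the sum is nonzero and has the required sign.\<close>
    have "y < h x \<longleftrightarrow> x < h y" using F_iff[OF xy] F_iff[OF xy(2,1)] sym by blast
    then show "F x y \<longleftrightarrow> b x + b y < 0" "b x + b y \<noteq> 0"
      unfolding F_iff[OF xy] b_def Let_def by (auto split: if_splits)
  qed
qed

lemma TG_in_image:
  assumes n: "n \<ge> 1" and TG: "(w, E) \<in> TG n"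
  obtains u where "u \<in> even_signed_perms n" "lam n u = w" "edges_of n u = E"
proof -
  have thr: "threshold_graph ({1..n}, E)" and deg: "sorted_wrt (\<ge>) (map (degree E) w)"
    and w: "set w = {1..n}" "distinct w"
    using TG by (auto simp: TG_def degree_ordering_def permutations_of_set_def)
  have G: "simple_graph ({1..n}, E)" using thr by (simp add: threshold_graph_def)
  have len: "length w = n" using distinct_card[OF w(2)] w(1) by simp
  have w_in: "w ! x \<in> {1..n}" if "x < n" for x using nth_mem[of x w] w(1) len that by simp
  have w_eq: "w ! x = w ! y \<longleftrightarrow> x = y" if "x < n" "y < n" for x y
    using nth_eq_iff_index_eq[OF w(2)] len that by simp
  \<comment> \<open>Moving one end of an edge to an earlier place in \<open>w\<close> keeps it an
    edge, by nested neighbourhoods.\<close>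
  have shift: "{w ! x', w ! y} \<in> E"
    if "{w ! x, w ! y} \<in> E" "x' < x" "x < n" "y < n" "y \<noteq> x" "y \<noteq> x'" for x x' y
  proof -
    have le: "degree E (w ! x) \<le> degree E (w ! x')"
      using sorted_wrt_nth_less[OF deg, of x' x] len that by simp
    show ?thesis
      by (rule threshold_neighbours_nested[OF thr finite_atLeastAtMost w_in w_in _ _ _ that(1)])
        (use that le in \<open>simp_all add: w_eq\<close>)
  qed

  text \<open>The graph leaves open how far the diagonal of the diagram is filled. Filled up to the
    last edge between consecutive vertices or one cell further, it is a diagram; exactly one of
    these two choices is even.\<close>

  define S where "S = {x. x + 1 < n \<and> {w ! x, w ! (x + 1)} \<in> E}"
  have "S \<subseteq> {..<n - 1}" by (auto simp: S_def)
  then have cardS: "card S \<le> n - 1" and "finite S"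
    using card_mono[of "{..<n - 1}" S] finite_subset[of S "{..<n - 1}"] by auto
  \<comment> \<open>An edge between places \<open>x\<close> and \<open>x + 1\<close> moves to
    \<open>y\<close> and \<open>y + 1\<close> in two shifts, first its earlier end and then its
    later one.\<close>
  have S: "S = {..<card S}"
  proof (rule downset_nat_eq_lessThan_card[OF \<open>finite S\<close>])
    fix x y assume x: "x \<in> S" and "y < x"
    then have "{w ! y, w ! (x + 1)} \<in> E"
      using shift[of x "x + 1" y] by (simp add: S_def)
    then have "{w ! (x + 1), w ! y} \<in> E" by (simp add: insert_commute)
    then have "{w ! (y + 1), w ! y} \<in> E"
      using shift[of "x + 1" y "y + 1"] x \<open>y < x\<close> by (simp add: S_def)
    then show "y \<in> S" using x \<open>y < x\<close> by (simp add: S_def insert_commute)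
  qed
  \<comment> \<open>This is the even one of \<open>card S\<close> and \<open>card S + 1\<close>. It
    is at most \<open>n\<close> because \<open>card S \<le> n - 1\<close> and
    \<open>n \<ge> 1\<close>.\<close>
  define m where "m = card S + card S mod 2"
  have m: "even m" "m \<le> n" "card S \<le> m" "m \<le> card S + 1"
    using cardS n by (auto simp: m_def)
  have consecutive: "{w ! x, w ! (x + 1)} \<in> E \<longleftrightarrow> x < card S" if "x + 1 < n" for x
    using S that by (auto simp: S_def)
  define F where "F x y \<longleftrightarrow> (if x = y then x < m else {w ! x, w ! y} \<in> E)" for x y
  have F_sym: "F x y \<longleftrightarrow> F y x" for x y by (auto simp: F_def insert_commute)
  have F_down: "\<forall>x<n. \<forall>y<n. \<forall>x'<x. F x y \<longrightarrow> F x' y"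
  proof (intro allI impI)
    fix x y x' assume that: "x < n" "y < n" "x' < x" "F x y"
    \<comment> \<open>Only diagonal cells need the bounds on \<open>m\<close>. If the given cell is
      diagonal, \<open>m \<le> card S + 1\<close> supplies the edge between places
      \<open>x - 1\<close> and \<open>x\<close>, which is moved to \<open>x'\<close>. If the target
      is diagonal, the given edge is moved to places \<open>y\<close> and \<open>y + 1\<close>, so
      \<open>y < card S \<le> m\<close>.\<close>
    consider "x = y" | "x' = y" | "x \<noteq> y" "x' \<noteq> y" by blast
    then show "F x' y"
    proof cases
      case 1
      then have "x - 1 < card S" using that m by (simp add: F_def)
      then have *: "{w ! (x - 1), w ! x} \<in> E" using consecutive[of "x - 1"] that by simp
      have "{w ! x', w ! x} \<in> E"
        using shift[OF *, of x'] * that by (cases "x' = x - 1") auto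
      then show ?thesis using 1 that by (simp add: F_def)
    next
      case 2
      then have *: "{w ! x, w ! y} \<in> E" using that by (simp add: F_def)
      have "{w ! (y + 1), w ! y} \<in> E"
        using shift[OF *, of "y + 1"] * 2 that by (cases "x = y + 1") auto
      then have "y < card S" using consecutive[of y] 2 that by (simp add: insert_commute)
      then show ?thesis using 2 m by (simp add: F_def)
    next
      case 3
      then show ?thesis using that shift[of x y x'] by (simp add: F_def)
    qed
  qed
  obtain b :: "nat \<Rightarrow> int" where b: "\<forall>x<n. b x \<in> {- int n..int n} - {0}"
      "\<forall>y<n. \<forall>x<y. b x < b y" "\<forall>x<n. \<forall>y<n. F x y \<longleftrightarrow> b x + b y < 0"
      "\<forall>x<n. \<forall>y<n. b x + b y \<noteq> 0"
    using weights_of_symmetric_diagram[of F n, OF F_sym F_down] by (elim exE conjE)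
  note b_range = b(1)[rule_format] and b_less = b(2)[rule_format]
    and b_F = b(3)[rule_format] and b_nonzero = b(4)[rule_format]
  define index where "index = inv_into {..<n} ((!) w)"
  have w_bij: "bij_betw ((!) w) {..<n} {1..n}"
    using bij_betw_nth[OF w(2), of "{..<n}" "{1..n}"] len w(1) by simp
  have index_w: "index (w ! x) = x" if "x < n" for x
    unfolding index_def using bij_betw_inv_into_left[OF w_bij] that by simp
  have w_cases: "\<exists>x. x < n \<and> i = w ! x" if "i \<in> {1..n}" for i
    using that unfolding w(1)[symmetric] in_set_conv_nth len by auto
  have "\<exists>u \<in> signed_perms n. \<forall>i \<in> {1..n}. weight u i = b (index i)"
  proof (rule signed_perm_of_weights[of n "\<lambda>i. b (index i)"])
    show "inj_on (\<lambda>i. b (index i)) {1..n}"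
    proof (rule inj_onI)
      fix i j assume i: "i \<in> {1..n}" and j: "j \<in> {1..n}" and eq: "b (index i) = b (index j)"
      obtain x y where "x < n" "i = w ! x" "y < n" "j = w ! y"
        using w_cases[OF i] w_cases[OF j] by blast
      then show "i = j"
        using eq b_less[of x y] b_less[of y x] by (cases x y rule: linorder_cases) (auto simp: index_w)
    qed
    show "b (index i) \<in> {- int n..int n} - {0}" if i: "i \<in> {1..n}" for i
    proof -
      obtain x where x: "x < n" "i = w ! x" using w_cases[OF i] by blast
      show ?thesis unfolding x(2) index_w[OF x(1)] by (rule b_range[OF x(1)])
    qed
    show "b (index i) + b (index j) \<noteq> 0" if ij: "i \<in> {1..n}" "j \<in> {1..n}" for i j
    proof -
      obtain x y where x: "x < n" "i = w ! x" and y: "y < n" "j = w ! y"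
        using w_cases[OF ij(1)] w_cases[OF ij(2)] by blast
      show ?thesis
        unfolding x(2) y(2) index_w[OF x(1)] index_w[OF y(1)] by (rule b_nonzero[OF x(1) y(1)])
    qed
  qed
  then obtain u where u: "u \<in> signed_perms n"
    and wb: "\<forall>i \<in> {1..n}. weight u i = b (index i)" by (rule bexE)
  have weight: "weight u (w ! x) = b x" if "x < n" for x
    using bspec[OF wb w_in[OF that]] by (simp only: index_w[OF that])
  show thesis
  proof (rule that)
    \<comment> \<open>A weight \<open>b x\<close> is negative exactly when the diagonal cell
      \<open>F x x\<close> is present, so there are \<open>m\<close> negative weights and
      \<open>u\<close> is even.\<close>
    have "{i \<in> {1..n}. weight u i < 0} = (!) w ` {..<m}"
    proof (intro equalityI subsetI)
      fix i assume i: "i \<in> {i \<in> {1..n}. weight u i < 0}"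
      then obtain x where x: "x < n" "i = w ! x" using w_cases by blast
      then have "F x x" using i weight b_F by simp
      then show "i \<in> (!) w ` {..<m}" using x by (simp add: F_def)
    next
      fix i assume "i \<in> (!) w ` {..<m}"
      then obtain x where x: "x < m" "i = w ! x" by auto
      then have "x < n" using m by simp
      moreover have "F x x" using x by (simp add: F_def)
      ultimately show "i \<in> {i \<in> {1..n}. weight u i < 0}"
        using x b_F[of x x] weight w_in by simp
    qed
    then have "card {i \<in> {1..n}. weight u i < 0} = m"
      using inj_on_subset[OF bij_betw_imp_inj_on[OF w_bij], of "{..<m}"] m by (simp add: card_image)
    then show "u \<in> even_signed_perms n"
      using u m card_negative[OF u] by (simp add: even_signed_perms_def)
    show "lam n u = w"
      by (rule lam_eqI[OF u w(1)]) (use weight b_less len in \<open>auto simp: sorted_wrt_iff_nth_less\<close>)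
    have iff: "{i, j} \<in> edges_of n u \<longleftrightarrow> {i, j} \<in> E" if ij: "i \<in> {1..n}" "j \<in> {1..n}" "i \<noteq> j" for i j
    proof -
      obtain x y where "x < n" "i = w ! x" "y < n" "j = w ! y"
        using w_cases[OF ij(1)] w_cases[OF ij(2)] by blast
      moreover from this have "x \<noteq> y" using ij(3) by blast
      ultimately show ?thesis
        using edge_iff[OF u ij] b_F[of x y] weight[of x] weight[of y] by (simp add: F_def)
    qed
    have pair: "\<exists>i j. e = {i, j} \<and> i \<in> {1..n} \<and> j \<in> {1..n} \<and> i \<noteq> j"
      if "simple_graph ({1..n}, D)" "e \<in> D" for e D
    proof -
      have "card e = 2" "e \<subseteq> {1..n}" using that by (simp_all add: simple_graph_def)
      then show ?thesis unfolding card_2_iff by blast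
    qed
    show "edges_of n u = E"
    proof (rule set_eqI)
      fix e
      show "e \<in> edges_of n u \<longleftrightarrow> e \<in> E"
        using pair[OF simple_edges_of[OF u], of e] pair[OF G, of e] iff by blast
    qed
  qed
qed

theorem mainTheorem4:
  fixes n :: nat
  assumes "n \<ge> 1"
  shows "bij_betw (\<lambda>u. (lam n u, edges_of n u)) (even_signed_perms n) (TG n)"
proof (rule bij_betw_imageI[OF lam_edges_inj], intro equalityI subsetI)
  fix p assume "p \<in> (\<lambda>u. (lam n u, edges_of n u)) ` even_signed_perms n"
  then obtain u where "u \<in> even_signed_perms n" "p = (lam n u, edges_of n u)" by (rule imageE)
  then show "p \<in> TG n" by (simp add: even_signed_perms_def lam_edges_in_TG)
next
  fix p assume "p \<in> TG n"
  then have "(fst p, snd p) \<in> TG n" by simp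
  then obtain u where u: "u \<in> even_signed_perms n" "lam n u = fst p" "edges_of n u = snd p"
    by (rule TG_in_image[OF assms])
  show "p \<in> (\<lambda>u. (lam n u, edges_of n u)) ` even_signed_perms n"
    by (rule image_eqI[OF _ u(1)]) (simp add: u(2,3))
qed

end
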